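(* Let $\alpha>0$ and $\beta\in[0,1]$. For every CaTL+ formula $\Phi$ and time $t$, the exponential robustness $\eta(\mathbf S,\Phi,t)$ (with parameters $\alpha,\beta$) is continuous everywhere and differentiable almost everywhere with respect to the individual trajectories $\mathbf s_j$, $j\in\mathcal J$.
   Context: Setting. $\mathcal J$ is a finite set of agents, $Cap$ a finite set of capabilities, agent $j$ has capabilities $Cap_j\subseteq Cap$ with $\bigcup_j Cap_j=Cap$, and $\mathcal J_c=\{j\in\mathcal J: c\in Cap_j\}$. The workspace is $\mathcal S\subseteq\mathbb R^{n_s}$. An individual trajectory is a finite sequence $\mathbf s_j=s_j(0)\ldots s_j(H)$ of points of $\mathcal S$ (with $H$ large enough for $\Phi$ to be evaluated at $t$); a team trajectory is $\mathbf S=\{(\mathbf s_j,Cap_j)\}_{j\in\mathcal J}$. Time is integer valued. The capabilities are fixed, so $\eta(\mathbf S,\Phi,t)$ is a function of the vector of all positions $(s_j(\tau))_{j\in\mathcal J,\,0\le\tau\le H}$; "almost everywhere" is with respect to Lebesgue measure. Syntax. Inner logic (STL): $\varphi:=True\mid\mu\mid\neg\varphi\mid\varphi_1\land\varphi_2\mid\varphi_1\lor\varphi_2\mid\varphi_1\mathbf U_{[a,b]}\varphi_2$, where each predicate $\mu$ has the form $h(s(t))\ge0$ with $h:\mathcal S\to\mathbb R$ differentiable, and $a\le b$ are nonnegative integers. Outer logic (CaTL+): $\Phi:=True\mid T\mid\neg\Phi\mid\Phi_1\land\Phi_2\mid\Phi_1\lor\Phi_2\mid\Phi_1\mathbf U_{[a,b]}\Phi_2$,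 where a task is $T=\langle\varphi,c,m\rangle$ with $\varphi$ an inner formula, $c\in Cap$, and $m$ a positive integer with $m\le|\mathcal J_c|$. In both logics, eventually is $\mathbf F_{[a,b]}\psi=True\,\mathbf U_{[a,b]}\psi$ and always is $\mathbf G_{[a,b]}\psi=\neg\mathbf F_{[a,b]}\neg\psi$. Exponential robustness. It is a real number $\eta(\mathbf s,\varphi,t)$ for inner formulas and $\eta(\mathbf S,\Phi,t)$ for outer formulas, defined recursively. The robustness of $True$ is a fixed positive constant. The robustness of a predicate $h(s(t))\ge0$ is $h(s(t))$. The robustness of $\neg\psi$ is minus that of $\psi$. Conjunction of $M$ subformulas with robustness $\eta_1,\dots,\eta_M$: let $\eta_{min}=\min_i\eta_i$ and $$\eta_i^{conj}=\begin{cases}\eta_{min}\,e^{(\eta_i-\eta_{min})/\eta_{min}}&\eta_{min}<0\\ \eta_{min}\bigl(2-e^{(\eta_{min}-\eta_i)/\eta_{min}}\bigr)&\eta_{min}>0\\ 0&\eta_{min}=0\end{cases}$$ and $\mathcal A^{exp}(\eta_1,\dots,\eta_M)=\beta\eta_{min}+(1-\beta)\frac1M\sum_{i=1}^M\eta_i^{conj}$. Disjunction (De Morgan): $-\mathcal A^{exp}(-\eta_1,\dots,-\eta_M)$. Always $\mathbf G_{[a,b]}\psi$ at $t$ is the conjunction, and eventually $\mathbf F_{[a,b]}\psi$ the disjunction, of the values for $\psi$ at times $t+a,\dots,t+b$. Until $\psi_1\mathbf U_{[a,b]}\psi_2$ at $t$ is the disjunction over $t'\in\{t+a,\dots,t+b\}$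 of the conjunction of $\psi_2$ at $t'$ and $\psi_1$ at $t,\dots,t'-1$. Task $\langle\varphi,c,m\rangle$ at $t$: with $n=|\mathcal J_c|$, order the values $\eta_j=\eta(\mathbf s_j,\varphi,t)$, $j\in\mathcal J_c$, as $\eta_{j_1}\ge\dots\ge\eta_{j_n}$. Put $$\eta_{j_k}^{task}=\begin{cases}\dfrac{2\alpha(e^{\eta_{j_m}}-1)}{1+e^{-\alpha(\eta_{j_k}-\eta_{j_m})}}&\eta_{j_m}>0\\[2mm] \dfrac{-2\alpha(e^{-\eta_{j_m}}-1)}{1+e^{\alpha(\eta_{j_k}-\eta_{j_m})}}&\eta_{j_m}\le0\end{cases}$$ and $\eta(\mathbf S,\langle\varphi,c,m\rangle,t)=\frac1n\sum_{k=1}^n\eta_{j_k}^{task}$. *)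

theory Defs
  imports "HOL-Analysis.Analysis" "HOL-Library.Multiset"
begin

text \<open>
  The inner and the outer logic have the same connectives and differ only in their atoms, so both
  are instances of one datatype of formulas over atoms \<open>'p\<close>.

  Conjunction and disjunction take lists because their exponential robustness is not associative:
  a conjunction of three subformulas is not a nested binary one. The binary connectives
  are the case of lists of length two.

  \<open>Ev a b \<psi>\<close> is the formula "True until \<open>\<psi>\<close>", but its robustness is the disjunction of the
  values of \<open>\<psi>\<close>. The clause for \<open>Until\<close> would give \<open>Until a b Tru \<psi>\<close> another value, because the
  constant for \<open>Tru\<close> enters the averages. Both formulas are therefore kept.
\<close>

datatype 'p fm =
    Tru
  | Atom 'p
  | Neg "'p fm"
  | Conj "'p fm list"
  | Disj "'p fm list"
  | Until nat nat "'p fm" "'p fm"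
  | Ev nat nat "'p fm"

definition Alw :: "nat \<Rightarrow> nat \<Rightarrow> 'p fm \<Rightarrow> 'p fm" where
  "Alw a b \<psi> = Neg (Ev a b (Neg \<psi>))"

text \<open>The function \<open>h\<close> stands for the predicate \<open>h (s t) \<ge> 0\<close>.\<close>

type_synonym 'a stl = "('a \<Rightarrow> real) fm"

datatype ('a, 'c) task = Task "'a stl" 'c nat

type_synonym ('a, 'c) catl = "('a, 'c) task fm"

fun wf_fm :: "('p \<Rightarrow> bool) \<Rightarrow> 'p fm \<Rightarrow> bool" where
  "wf_fm P Tru = True"
| "wf_fm P (Atom p) = P p"
| "wf_fm P (Neg \<phi>) = wf_fm P \<phi>"
| "wf_fm P (Conj \<phi>s) = (\<phi>s \<noteq> [] \<and> (\<forall>\<phi>\<in>set \<phi>s. wf_fm P \<phi>))"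
| "wf_fm P (Disj \<phi>s) = (\<phi>s \<noteq> [] \<and> (\<forall>\<phi>\<in>set \<phi>s. wf_fm P \<phi>))"
| "wf_fm P (Until a b \<phi> \<psi>) = (a \<le> b \<and> wf_fm P \<phi> \<and> wf_fm P \<psi>)"
| "wf_fm P (Ev a b \<psi>) = (a \<le> b \<and> wf_fm P \<psi>)"

definition wf_stl :: "'a::real_normed_vector set \<Rightarrow> 'a stl \<Rightarrow> bool" where
  "wf_stl S = wf_fm (\<lambda>h. h differentiable_on S)"

definition capable :: "('j \<Rightarrow> 'c set) \<Rightarrow> 'c \<Rightarrow> 'j set" where
  "capable cap c = {j. c \<in> cap j}"

fun wf_task :: "'a::real_normed_vector set \<Rightarrow> 'c set \<Rightarrow> ('j \<Rightarrow> 'c set) \<Rightarrow> ('a, 'c) task \<Rightarrow> bool" where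
  "wf_task S Cap cap (Task \<phi> c m) =
     (wf_stl S \<phi> \<and> c \<in> Cap \<and> 1 \<le> m \<and> m \<le> card (capable cap c))"

definition wf_catl :: "'a::real_normed_vector set \<Rightarrow> 'c set \<Rightarrow> ('j \<Rightarrow> 'c set) \<Rightarrow> ('a, 'c) catl \<Rightarrow> bool" where
  "wf_catl S Cap cap = wf_fm (wf_task S Cap cap)"

text \<open>
  Evaluating a formula at time \<open>t\<close> inspects positions at times up to \<open>t\<close> plus its horizon; the
  first argument gives the horizon of an atom. In \<open>Until a b \<phi> \<psi>\<close>, \<open>\<phi>\<close> is evaluated only at
  times strictly before \<open>t + b\<close>.
\<close>

fun horizon :: "('p \<Rightarrow> nat) \<Rightarrow> 'p fm \<Rightarrow> nat" where
  "horizon f Tru = 0"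
| "horizon f (Atom p) = f p"
| "horizon f (Neg \<phi>) = horizon f \<phi>"
| "horizon f (Conj \<phi>s) = Max (insert 0 (horizon f ` set \<phi>s))"
| "horizon f (Disj \<phi>s) = Max (insert 0 (horizon f ` set \<phi>s))"
| "horizon f (Until a b \<phi> \<psi>) =
     (if b = 0 then horizon f \<psi> else max (b - 1 + horizon f \<phi>) (b + horizon f \<psi>))"
| "horizon f (Ev a b \<psi>) = b + horizon f \<psi>"

fun horizon_task :: "('a, 'c) task \<Rightarrow> nat" where
  "horizon_task (Task \<phi> c m) = horizon (\<lambda>h. 0) \<phi>"

definition horizon_catl :: "('a, 'c) catl \<Rightarrow> nat" where
  "horizon_catl = horizon horizon_task"

definition eta_conj :: "real \<Rightarrow> real \<Rightarrow> real" where
  "eta_conj \<eta>min \<eta> =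
     (if \<eta>min < 0 then \<eta>min * exp ((\<eta> - \<eta>min) / \<eta>min)
      else if \<eta>min > 0 then \<eta>min * (2 - exp ((\<eta>min - \<eta>) / \<eta>min))
      else 0)"

definition A_exp :: "real \<Rightarrow> real list \<Rightarrow> real" where
  "A_exp \<beta> \<eta>s =
     (let \<eta>min = Min (set \<eta>s)
      in \<beta> * \<eta>min + (1 - \<beta>) * ((\<Sum>\<eta>\<leftarrow>\<eta>s. eta_conj \<eta>min \<eta>) / real (length \<eta>s)))"

definition O_exp :: "real \<Rightarrow> real list \<Rightarrow> real" where
  "O_exp \<beta> \<eta>s = - A_exp \<beta> (map uminus \<eta>s)"

text \<open>
  \<open>rob \<beta> \<rho> r \<phi> t\<close> is the exponential robustness of \<open>\<phi>\<close> at time \<open>t\<close>, where \<open>\<rho>\<close> is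
  the constant for \<open>Tru\<close> and \<open>r p t\<close> the robustness of the atom \<open>p\<close> at time \<open>t\<close>.
\<close>

fun rob :: "real \<Rightarrow> real \<Rightarrow> ('p \<Rightarrow> nat \<Rightarrow> real) \<Rightarrow> 'p fm \<Rightarrow> nat \<Rightarrow> real" where
  "rob \<beta> \<rho> r Tru t = \<rho>"
| "rob \<beta> \<rho> r (Atom p) t = r p t"
| "rob \<beta> \<rho> r (Neg \<phi>) t = - rob \<beta> \<rho> r \<phi> t"
| "rob \<beta> \<rho> r (Conj \<phi>s) t = A_exp \<beta> (map (\<lambda>\<phi>. rob \<beta> \<rho> r \<phi> t) \<phi>s)"
| "rob \<beta> \<rho> r (Disj \<phi>s) t = O_exp \<beta> (map (\<lambda>\<phi>. rob \<beta> \<rho> r \<phi> t) \<phi>s)"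
| "rob \<beta> \<rho> r (Until a b \<phi> \<psi>) t =
     O_exp \<beta> (map (\<lambda>t'. A_exp \<beta> (rob \<beta> \<rho> r \<psi> t' # map (\<lambda>t''. rob \<beta> \<rho> r \<phi> t'') [t..<t']))
       [t + a..<Suc (t + b)])"
| "rob \<beta> \<rho> r (Ev a b \<psi>) t = O_exp \<beta> (map (\<lambda>t'. rob \<beta> \<rho> r \<psi> t') [t + a..<Suc (t + b)])"

lemma rob_Alw:
  "rob \<beta> \<rho> r (Alw a b \<psi>) t = A_exp \<beta> (map (\<lambda>t'. rob \<beta> \<rho> r \<psi> t') [t + a..<Suc (t + b)])"
  by (simp add: Alw_def O_exp_def comp_def del: upt_Suc)

definition rob_stl :: "real \<Rightarrow> real \<Rightarrow> (nat \<Rightarrow> 'a) \<Rightarrow> 'a stl \<Rightarrow> nat \<Rightarrow> real" where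
  "rob_stl \<beta> \<rho> s = rob \<beta> \<rho> (\<lambda>h t. h (s t))"

definition eta_task :: "real \<Rightarrow> real \<Rightarrow> real \<Rightarrow> real" where
  "eta_task \<alpha> \<eta>m \<eta> =
     (if \<eta>m > 0 then 2 * \<alpha> * (exp \<eta>m - 1) / (1 + exp (- \<alpha> * (\<eta> - \<eta>m)))
      else - 2 * \<alpha> * (exp (- \<eta>m) - 1) / (1 + exp (\<alpha> * (\<eta> - \<eta>m))))"

text \<open>The values \<open>f j\<close>, \<open>j \<in> A\<close>, with multiplicities, in descending order.\<close>

definition desc_values :: "('j \<Rightarrow> real) \<Rightarrow> 'j set \<Rightarrow> real list" where
  "desc_values f A = rev (sorted_list_of_multiset (image_mset f (mset_set A)))"

fun rob_task :: "real \<Rightarrow> real \<Rightarrow> real \<Rightarrow> ('j \<Rightarrow> 'c set) \<Rightarrow> ('j \<Rightarrow> nat \<Rightarrow> 'a)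
    \<Rightarrow> ('a, 'c) task \<Rightarrow> nat \<Rightarrow> real" where
  "rob_task \<alpha> \<beta> \<rho> cap s (Task \<phi> c m) t =
     (let \<eta>s = desc_values (\<lambda>j. rob_stl \<beta> \<rho> (s j) \<phi> t) (capable cap c)
      in (\<Sum>\<eta>\<leftarrow>\<eta>s. eta_task \<alpha> (\<eta>s ! (m - 1)) \<eta>) / real (card (capable cap c)))"

definition rob_catl :: "real \<Rightarrow> real \<Rightarrow> real \<Rightarrow> ('j \<Rightarrow> 'c set) \<Rightarrow> ('j \<Rightarrow> nat \<Rightarrow> 'a)
    \<Rightarrow> ('a, 'c) catl \<Rightarrow> nat \<Rightarrow> real" where
  "rob_catl \<alpha> \<beta> \<rho> cap s = rob \<beta> \<rho> (rob_task \<alpha> \<beta> \<rho> cap s)"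

text \<open>
  The vector of all positions lives in \<open>real^'n^'k^'j\<close>, where \<open>'j\<close> is the type of agents and
  \<open>'k\<close> has \<open>H + 1\<close> elements, identified with the times \<open>0, \<dots>, H\<close> by a map \<open>\<tau>\<close>.
\<close>

definition team_positions :: "(real^'n) set \<Rightarrow> (real^'n^'k^'j) set" where
  "team_positions S = {x. \<forall>j k. x $ j $ k \<in> S}"

definition trajectories :: "(nat \<Rightarrow> 'k) \<Rightarrow> real^'n^'k^'j \<Rightarrow> 'j \<Rightarrow> nat \<Rightarrow> real^'n" where
  "trajectories \<tau> x j i = x $ j $ \<tau> i"

end

theory Submission imports Defs begin

text \<open>
  The robustness is built from differentiable functions by smooth operations and operations that
  can fail to be smooth only where two continuous functions agree: minima and order statistics at
  ties, the averages \<open>A_exp\<close> where the minimum vanishes, tasks where the \<open>m\<close>-th largest value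
  vanishes. If \<open>f\<close> has a nonzero derivative at each point of \<open>E \<subseteq> {f = 0}\<close>, then near each of its
  points \<open>E\<close> lies in arbitrarily thin slabs, hence has density zero there and is negligible. So
  almost everywhere on a tie set the competing functions have the same derivative, and a continuous
  selection from them is differentiable. Likewise \<open>G (u x) (v x)\<close> with \<open>\<bar>G a b\<bar> \<le> C * \<bar>a\<bar>\<close> has
  derivative zero almost everywhere on \<open>{u = 0}\<close>. No local Lipschitz bound and no theorem of
  Rademacher type is involved.
\<close>

section \<open>Null sets via density in thin slabs\<close>

lemma lmeasurable_slab:
  fixes v :: "'a::euclidean_space"
  shows "{y \<in> ball a r. \<bar>v \<bullet> (y - a)\<bar> \<le> c} \<in> lmeasurable"
proof -
  have "closed {y. \<bar>v \<bullet> (y - a)\<bar> \<le> c}"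
    by (intro closed_Collect_le continuous_intros)
  then have "ball a r \<inter> {y. \<bar>v \<bullet> (y - a)\<bar> \<le> c} \<in> lmeasurable"
    by (intro fmeasurable_Int_fmeasurable) auto
  then show ?thesis by (simp add: Int_def)
qed

text \<open>The slabs of width \<open>inverse (real (Suc n))\<close> decrease to a piece of a
  hyperplane, which is null. They lie in a ball, so their measures are finite and converge to that
  of the intersection.\<close>

lemma thin_slab:
  fixes v :: "'a::euclidean_space"
  assumes "v \<noteq> 0" "0 < e"
  obtains \<xi> where "0 < \<xi>" "measure lebesgue {y \<in> ball 0 1. \<bar>v \<bullet> y\<bar> \<le> \<xi>} < e"
proof -
  define A where "A = (\<lambda>n::nat. {y \<in> ball (0::'a) 1. \<bar>v \<bullet> y\<bar> \<le> inverse (real (Suc n))})"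
  have lm: "A n \<in> lmeasurable" for n
    using lmeasurable_slab[of 0 1 v] by (simp add: A_def)
  have dec: "decseq A"
    by (rule decseq_SucI) (auto simp: A_def field_simps intro: order_trans)
  have fin: "emeasure lebesgue (A n) \<noteq> \<infinity>" for n
    using fmeasurableD2[OF lm[of n]] by simp
  have "(\<lambda>n. measure lebesgue (A n)) \<longlonglongrightarrow> measure lebesgue (\<Inter>n. A n)"
    using lm dec fin by (intro Lim_measure_decseq) auto
  moreover have "negligible (\<Inter>n. A n)"
  proof (rule negligible_subset)
    show "negligible {y. v \<bullet> y = 0}"
      using assms by (simp add: negligible_hyperplane)
    show "(\<Inter>n. A n) \<subseteq> {y. v \<bullet> y = 0}"
    proof
      fix y assume "y \<in> (\<Inter>n. A n)"
      then have le: "\<bar>v \<bullet> y\<bar> \<le> inverse (real (Suc n))" for n by (auto simp: A_def)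
      have "v \<bullet> y = 0"
      proof (rule ccontr)
        assume "v \<bullet> y \<noteq> 0"
        then obtain n where "inverse (real (Suc n)) < \<bar>v \<bullet> y\<bar>"
          using reals_Archimedean[of "\<bar>v \<bullet> y\<bar>"] by auto
        with le[of n] show False by simp
      qed
      then show "y \<in> {y. v \<bullet> y = 0}" by simp
    qed
  qed
  ultimately have "(\<lambda>n. measure lebesgue (A n)) \<longlonglongrightarrow> 0"
    by (simp add: negligible_imp_measure0)
  then have "\<forall>\<^sub>F n in sequentially. measure lebesgue (A n) < e"
    using assms(2) by (rule order_tendstoD)
  then obtain n where "measure lebesgue (A n) < e"
    by (auto simp: eventually_sequentially)
  then show ?thesis
    using that[of "inverse (real (Suc n))"] by (auto simp: A_def)
qed

text \<open>The slab condition is invariant under rescaling, so a width found in the unit ball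
  controls the density of \<open>E\<close> in all small balls about \<open>x\<close>. The density
  criterion asks only for a measurable cover, so \<open>E\<close> can be any set.\<close>

lemma negligible_flat:
  fixes E :: "'a::euclidean_space set"
  assumes flat: "\<And>x. x \<in> E \<Longrightarrow> \<exists>v. v \<noteq> 0 \<and> (\<forall>\<xi>>0. \<exists>d>0. \<forall>y\<in>E. norm (y - x) < d \<longrightarrow>
    \<bar>v \<bullet> (y - x)\<bar> \<le> \<xi> * norm (y - x))"
  shows "negligible E"
  unfolding negligible_eq_zero_density
proof (intro ballI allI impI)
  fix x r e assume x: "x \<in> E" and r: "(0::real) < r" and e: "(0::real) < e"
  obtain v where v: "v \<noteq> 0" and fl: "\<forall>\<xi>>0. \<exists>d>0. \<forall>y\<in>E. norm (y - x) < d \<longrightarrow>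
      \<bar>v \<bullet> (y - x)\<bar> \<le> \<xi> * norm (y - x)"
    using flat[OF x] by blast
  let ?W = "\<lambda>\<xi>. {y \<in> ball (0::'a) 1. \<bar>v \<bullet> y\<bar> \<le> \<xi>}"
  \<comment> \<open>The width depends on \<open>v\<close> and \<open>e\<close> alone; flatness then
    supplies the radius \<open>d0\<close> for it.\<close>
  obtain \<xi> where \<xi>: "0 < \<xi>" "measure lebesgue (?W \<xi>) < e * measure lebesgue (ball (0::'a) 1)"
    using v e content_ball_pos[of 1 "0::'a"]
    by (auto intro: thin_slab[of v "e * measure lebesgue (ball (0::'a) 1)"])
  obtain d0 where d0: "d0 > 0" "\<And>y. y \<in> E \<Longrightarrow> norm (y - x) < d0 \<Longrightarrow>
      \<bar>v \<bullet> (y - x)\<bar> \<le> \<xi> * norm (y - x)"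
    using fl \<xi>(1) by blast
  define d where "d = min r d0"
  have d: "0 < d" "d \<le> r" "d \<le> d0" using r d0 by (auto simp: d_def)
  define U where "U = {y \<in> ball x d. \<bar>v \<bullet> (y - x)\<bar> \<le> \<xi> * d}"
  \<comment> \<open>By rescaling, \<open>U\<close> and the ball both pick up the factor
    \<open>d ^ DIM('a)\<close>, so their ratio is that of the unit slab.\<close>
  have U: "U = (\<lambda>y. d *\<^sub>R y + x) ` ?W \<xi>"
  proof (intro equalityI subsetI)
    fix y assume "y \<in> U"
    then have "norm (y - x) < d" "\<bar>v \<bullet> (y - x)\<bar> / d \<le> \<xi>"
      using d by (auto simp: U_def dist_norm norm_minus_commute field_simps)
    then have "(y - x) /\<^sub>R d \<in> ?W \<xi>"
      using d by (simp add: abs_mult divide_inverse_commute[symmetric])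
    then show "y \<in> (\<lambda>y. d *\<^sub>R y + x) ` ?W \<xi>"
      using d by (intro image_eqI[of _ _ "(y - x) /\<^sub>R d"]) auto
  next
    fix y assume "y \<in> (\<lambda>y. d *\<^sub>R y + x) ` ?W \<xi>"
    then show "y \<in> U" using d by (auto simp: U_def dist_norm abs_mult mult.commute)
  qed
  have "E \<inter> ball x d \<subseteq> U"
  proof
    fix y assume y: "y \<in> E \<inter> ball x d"
    then have n: "norm (y - x) < d" by (simp add: dist_norm norm_minus_commute)
    then have "\<bar>v \<bullet> (y - x)\<bar> \<le> \<xi> * norm (y - x)"
      using y d by (intro d0(2)) auto
    also have "\<dots> \<le> \<xi> * d" using \<xi>(1) n by simp
    finally show "y \<in> U" using y by (simp add: U_def)
  qed
  moreover have "U \<in> lmeasurable"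
    unfolding U_def by (rule lmeasurable_slab)
  moreover have "measure lebesgue U < e * measure lebesgue (ball x d)"
  proof -
    have "measure lebesgue U = d ^ DIM('a) * measure lebesgue (?W \<xi>)"
      using d measure_lebesgue_affine[of d x "?W \<xi>"] by (simp add: U)
    also have "\<dots> < d ^ DIM('a) * (e * measure lebesgue (ball (0::'a) 1))"
      using \<xi>(2) d by simp
    also have "\<dots> = e * measure lebesgue (ball x d)"
      using d content_ball_conv_unit_ball[of d x] by simp
    finally show ?thesis .
  qed
  ultimately show "\<exists>d>0. d \<le> r \<and> (\<exists>U. E \<inter> ball x d \<subseteq> U \<and> U \<in> lmeasurable \<and>
      measure lebesgue U < e * measure lebesgue (ball x d))"
    using d by blast
qed

text \<open>
  As \<open>X\<close> is arbitrary, derivatives within \<open>X\<close> need not be unique: one nonzero derivative is enough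
  for a point to be exceptional, so outside the set every derivative vanishes.
\<close>

lemma negligible_zeros_nonzero_derivative:
  fixes f :: "'a::euclidean_space \<Rightarrow> real"
  shows "negligible {x\<in>X. f x = 0 \<and> (\<exists>D. (f has_derivative D) (at x within X) \<and> D \<noteq> (\<lambda>_. 0))}"
    (is "negligible ?E")
proof (rule negligible_flat)
  fix x assume "x \<in> ?E"
  then obtain D where fx: "f x = 0" and D: "(f has_derivative D) (at x within X)" and "D \<noteq> (\<lambda>_. 0)"
    by blast
  \<comment> \<open>The adjoint of a linear functional sends 1 to its representing vector, so
    \<open>v\<close> is the gradient.\<close>
  define v where "v = adjoint D 1"
  have Dv: "D y = v \<bullet> y" for y
    using adjoint_works[of D y 1] has_derivative_linear[OF D] by (simp add: v_def inner_commute)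
  show "\<exists>v. v \<noteq> 0 \<and> (\<forall>\<xi>>0. \<exists>d>0. \<forall>y\<in>?E. norm (y - x) < d \<longrightarrow>
      \<bar>v \<bullet> (y - x)\<bar> \<le> \<xi> * norm (y - x))"
  proof (intro exI[of _ v] conjI allI impI)
    show "v \<noteq> 0" using \<open>D \<noteq> (\<lambda>_. 0)\<close> Dv by (auto simp: fun_eq_iff)
    fix \<xi> :: real assume "0 < \<xi>"
    then obtain d where "d > 0"
      and d: "\<forall>y\<in>X. norm (y - x) < d \<longrightarrow> norm (f y - f x - D (y - x)) \<le> \<xi> * norm (y - x)"
      using D unfolding has_derivative_within_alt by blast
    \<comment> \<open>\<open>f\<close> vanishes at both \<open>x\<close> and \<open>y\<close>, so
      the differentiability estimate is a bound on \<open>D (y - x)\<close> alone.\<close>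
    then show "\<exists>d>0. \<forall>y\<in>?E. norm (y - x) < d \<longrightarrow> \<bar>v \<bullet> (y - x)\<bar> \<le> \<xi> * norm (y - x)"
      using fx Dv by (intro exI[of _ d]) auto
  qed
qed

section \<open>Continuous functions differentiable almost everywhere\<close>

definition cont_aediff :: "'a::euclidean_space set \<Rightarrow> ('a \<Rightarrow> real) \<Rightarrow> bool" where
  "cont_aediff X f \<longleftrightarrow>
     continuous_on X f \<and> negligible {x \<in> X. \<not> f differentiable (at x within X)}"

text \<open>Near \<open>x\<close>, continuity of \<open>g\<close> excludes the branches with another
  value at \<open>x\<close>. The others share the value and, off \<open>N\<close>, the derivative at
  \<open>x\<close>, so the active index may jump among them arbitrarily.\<close>

lemma cont_aediff_selection:
  assumes I: "finite I" and f: "\<And>i. i \<in> I \<Longrightarrow> cont_aediff X (f i)"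
    and g: "continuous_on X g" and sel: "\<And>x. x \<in> X \<Longrightarrow> \<exists>i\<in>I. g x = f i x"
  shows "cont_aediff X g"
  unfolding cont_aediff_def
proof
  define Z where "Z = (\<lambda>i j. {x\<in>X. f i x - f j x = 0 \<and>
    (\<exists>D. ((\<lambda>x. f i x - f j x) has_derivative D) (at x within X) \<and> D \<noteq> (\<lambda>_. 0))})"
  have negZ: "negligible (Z i j)" for i j
    unfolding Z_def by (rule negligible_zeros_nonzero_derivative)
  define N where "N = (\<Union>i\<in>I. {x \<in> X. \<not> f i differentiable (at x within X)}) \<union> (\<Union>i\<in>I. \<Union>j\<in>I. Z i j)"
  have "negligible N"
    unfolding N_def using I f negZ
    by (intro negligible_Un) (auto simp: cont_aediff_def intro!: negligible_Union)
  moreover have "g differentiable (at x within X)" if x: "x \<in> X" "x \<notin> N" for x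
  proof -
    have "\<forall>i\<in>I. \<exists>D. (f i has_derivative D) (at x within X)"
      using x by (auto simp: N_def differentiable_def)
    then obtain D where D: "\<And>i. i \<in> I \<Longrightarrow> (f i has_derivative D i) (at x within X)"
      by metis
    obtain k where k: "k \<in> I" "g x = f k x" using sel x by blast
    have same: "D i = D k" if i: "i \<in> I" "f i x = g x" for i
    proof -
      have "((\<lambda>x. f i x - f k x) has_derivative (\<lambda>y. D i y - D k y)) (at x within X)"
        using D i k by (intro has_derivative_diff)
      then have "(\<lambda>y. D i y - D k y) = (\<lambda>_. 0)"
        using x i k by (auto simp: N_def Z_def)
      then show ?thesis by (simp add: fun_eq_iff)
    qed
    have "(g has_derivative D k) (at x within X)"
      unfolding has_derivative_within_alt2
    proof (intro conjI allI impI)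
      show "bounded_linear (D k)" using D k has_derivative_bounded_linear by blast
      fix e :: real assume e: "0 < e"
      \<comment> \<open>One implication per branch: if \<open>g\<close> agrees with
        \<open>f i\<close> at \<open>y\<close>, the estimate holds there. Finitely many of these
        hold together, and each \<open>y\<close> in \<open>X\<close> has an active branch.\<close>
      have "\<forall>\<^sub>F y in at x within X. g y \<noteq> f i y \<or>
          norm (g y - g x - D k (y - x)) \<le> e * norm (y - x)" if i: "i \<in> I" for i
      proof (cases "f i x = g x")
        case True
        then have "\<forall>\<^sub>F y in at x within X. norm (f i y - f i x - D k (y - x)) \<le> e * norm (y - x)"
          using D[OF i] same[OF i] e unfolding has_derivative_within_alt2 by simp
        then show ?thesis by eventually_elim (use True in auto)
      next
        case False
        have "((\<lambda>y. g y - f i y) \<longlongrightarrow> g x - f i x) (at x within X)"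
          using f[OF i] g x by (auto simp: cont_aediff_def continuous_on_def intro!: tendsto_diff)
        then have "\<forall>\<^sub>F y in at x within X. g y - f i y \<noteq> 0"
          using False by (intro tendsto_imp_eventually_ne) auto
        then show ?thesis by eventually_elim auto
      qed
      then have "\<forall>\<^sub>F y in at x within X. \<forall>i\<in>I. g y \<noteq> f i y \<or>
          norm (g y - g x - D k (y - x)) \<le> e * norm (y - x)"
        using I by (simp add: eventually_ball_finite)
      moreover have "\<forall>\<^sub>F y in at x within X. y \<in> X" by (simp add: eventually_at_filter)
      ultimately show "\<forall>\<^sub>F y in at x within X. norm (g y - g x - D k (y - x)) \<le> e * norm (y - x)"
        by eventually_elim (use sel in blast)
    qed
    then show ?thesis by (auto simp: differentiable_def)
  qed
  ultimately show "negligible {x \<in> X. \<not> g differentiable (at x within X)}"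
    by (auto intro: negligible_subset)
qed (rule g)

text \<open>Here \<open>u\<close> is a minimum or an order statistic and \<open>v\<close> one of the
  values. The bound is asked only for pairs that occur, because \<open>eta_conj\<close> can blow up
  near 0 when its second argument lies below the first, and only for
  \<open>\<bar>u x\<bar> \<le> 1\<close>, because \<open>eta_task\<close> grows
  exponentially.\<close>

lemma cont_aediff_compose:
  fixes G :: "real \<Rightarrow> real \<Rightarrow> real"
  assumes u: "cont_aediff X u" and v: "cont_aediff X v"
    and smooth: "\<And>a b. a \<noteq> 0 \<Longrightarrow> case_prod G differentiable (at (a, b))"
    and bound: "\<And>x. x \<in> X \<Longrightarrow> \<bar>u x\<bar> \<le> 1 \<Longrightarrow> \<bar>G (u x) (v x)\<bar> \<le> C * \<bar>u x\<bar>"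
  shows "cont_aediff X (\<lambda>x. G (u x) (v x))" (is "cont_aediff X ?g")
proof -
  have smooth': "?g differentiable (at x within X)"
    if "u x \<noteq> 0" "u differentiable (at x within X)" "v differentiable (at x within X)" for x
  proof -
    have "(\<lambda>x. (u x, v x)) differentiable (at x within X)"
      using that by (auto simp: differentiable_def intro!: has_derivative_Pair)
    moreover have "case_prod G differentiable (at (u x, v x) within (\<lambda>x. (u x, v x)) ` X)"
      using smooth[OF that(1)] differentiable_at_withinI by blast
    ultimately show ?thesis
      using differentiable_chain_within[of "\<lambda>x. (u x, v x)" x X "case_prod G"] by (simp add: o_def)
  qed
  have cu: "continuous_on X u" and cv: "continuous_on X v"
    using u v by (auto simp: cont_aediff_def)
  have small: "\<forall>\<^sub>F y in at x within X. \<bar>?g y\<bar> \<le> C * \<bar>u y\<bar>" if x: "x \<in> X" "u x = 0" for x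
  proof -
    have "((\<lambda>y. \<bar>u y\<bar>) \<longlongrightarrow> \<bar>u x\<bar>) (at x within X)"
      using cu x by (intro tendsto_rabs) (auto simp: continuous_on_def)
    then have "\<forall>\<^sub>F y in at x within X. \<bar>u y\<bar> < 1"
      by (rule order_tendstoD) (use x in simp)
    moreover have "\<forall>\<^sub>F y in at x within X. y \<in> X" by (simp add: eventually_at_filter)
    ultimately show ?thesis by eventually_elim (use bound in auto)
  qed
  have g0: "?g x = 0" if "x \<in> X" "u x = 0" for x using bound[OF that(1)] that(2) by simp
  have "continuous_on X ?g"
    unfolding continuous_on_def
  proof
    fix x assume x: "x \<in> X"
    show "(?g \<longlongrightarrow> ?g x) (at x within X)"
    proof (cases "u x = 0")
      case True
      have "((\<lambda>y. C * \<bar>u y\<bar>) \<longlongrightarrow> C * \<bar>u x\<bar>) (at x within X)"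
        using cu x by (intro tendsto_mult tendsto_const tendsto_rabs) (auto simp: continuous_on_def)
      then have "((\<lambda>y. C * \<bar>u y\<bar>) \<longlongrightarrow> 0) (at x within X)" using True by simp
      moreover have "\<forall>\<^sub>F y in at x within X. norm (?g y) \<le> C * \<bar>u y\<bar>"
        using small[OF x True] by simp
      ultimately show ?thesis
        unfolding g0[OF x True] by (rule Lim_null_comparison[rotated])
    next
      case False
      have "isCont (case_prod G) (u x, v x)"
        using smooth[OF False] differentiable_imp_continuous_within by blast
      moreover have "((\<lambda>y. (u y, v y)) \<longlongrightarrow> (u x, v x)) (at x within X)"
        using cu cv x by (intro tendsto_Pair) (auto simp: continuous_on_def)
      ultimately show ?thesis
        using isCont_tendsto_compose[of "(u x, v x)" "case_prod G"] by fastforce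
    qed
  qed
  moreover have "negligible {x \<in> X. \<not> ?g differentiable (at x within X)}"
  proof (rule negligible_subset)
    let ?N = "\<lambda>f. {x \<in> X. \<not> f differentiable (at x within X)}"
    let ?Z = "{x\<in>X. u x = 0 \<and> (\<exists>D. (u has_derivative D) (at x within X) \<and> D \<noteq> (\<lambda>_. 0))}"
    show "negligible (?N u \<union> ?N v \<union> ?Z)"
      using u v unfolding cont_aediff_def
      by (intro negligible_Un negligible_zeros_nonzero_derivative) auto
    have "?g differentiable (at x within X)" if x: "x \<in> X" "u x = 0" "x \<notin> ?N u" "x \<notin> ?Z" for x
    proof -
      \<comment> \<open>Off \<open>?Z\<close> every derivative of \<open>u\<close> at a zero
        vanishes, so \<open>u\<close> is \<open>o(norm (y - x))\<close>; the linear bound passes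
        this on to \<open>?g\<close>.\<close>
      have D: "(u has_derivative (\<lambda>_. 0)) (at x within X)"
        using x by (auto simp: differentiable_def)
      have "(?g has_derivative (\<lambda>_. 0)) (at x within X)"
        unfolding has_derivative_within_alt2
      proof (intro conjI allI impI)
        fix e :: real assume e: "0 < e"
        \<comment> \<open>No sign is assumed for \<open>C\<close>; the divisor
          \<open>\<bar>C\<bar> + 1\<close> is always positive.\<close>
        then have "0 < e / (\<bar>C\<bar> + 1)" by simp
        then have "\<forall>\<^sub>F y in at x within X. norm (u y - u x - 0) \<le> e / (\<bar>C\<bar> + 1) * norm (y - x)"
          using D unfolding has_derivative_within_alt2 by blast
        then show "\<forall>\<^sub>F y in at x within X. norm (?g y - ?g x - 0) \<le> e * norm (y - x)"
          using small[OF x(1,2)]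
        proof eventually_elim
          case (elim y)
          have "\<bar>?g y\<bar> \<le> (\<bar>C\<bar> + 1) * \<bar>u y\<bar>"
            using elim(2) by (rule order_trans) (simp add: mult_right_mono)
          also have "\<dots> \<le> (\<bar>C\<bar> + 1) * (e / (\<bar>C\<bar> + 1) * norm (y - x))"
            using elim(1) x by (intro mult_left_mono) auto
          finally show ?case using g0[OF x(1,2)] by simp
        qed
      qed simp
      then show ?thesis by (auto simp: differentiable_def)
    qed
    then show "?N ?g \<subseteq> ?N u \<union> ?N v \<union> ?Z"
      using smooth' by blast
  qed
  ultimately show ?thesis by (simp add: cont_aediff_def)
qed

section \<open>Closure under linear operations and minima\<close>

lemma cont_aediff_differentiable_on:
  assumes "f differentiable_on X"
  shows "cont_aediff X f"
proof -
  have "{x \<in> X. \<not> f differentiable (at x within X)} = {}"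
    using assms by (auto simp: differentiable_on_def)
  with assms show ?thesis
    unfolding cont_aediff_def by (metis differentiable_imp_continuous_on negligible_empty)
qed

lemma cont_aediff_const: "cont_aediff X (\<lambda>x. c)"
  by (simp add: cont_aediff_differentiable_on)

lemma cont_aediff_add:
  assumes "cont_aediff X f" "cont_aediff X g"
  shows "cont_aediff X (\<lambda>x. f x + g x)"
  unfolding cont_aediff_def
proof
  show "continuous_on X (\<lambda>x. f x + g x)"
    using assms by (auto simp: cont_aediff_def intro: continuous_on_add)
  have "negligible ({x \<in> X. \<not> f differentiable (at x within X)} \<union>
      {x \<in> X. \<not> g differentiable (at x within X)})"
    using assms by (auto simp: cont_aediff_def intro: negligible_Un)
  then show "negligible {x \<in> X. \<not> (\<lambda>x. f x + g x) differentiable (at x within X)}"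
    by (rule negligible_subset) (auto intro: differentiable_add)
qed

lemma cont_aediff_mult_left:
  assumes "cont_aediff X f"
  shows "cont_aediff X (\<lambda>x. c * f x)"
  unfolding cont_aediff_def
proof
  show "continuous_on X (\<lambda>x. c * f x)"
    using assms by (auto simp: cont_aediff_def intro: continuous_on_mult_left)
  have "negligible {x \<in> X. \<not> f differentiable (at x within X)}"
    using assms by (simp add: cont_aediff_def)
  then show "negligible {x \<in> X. \<not> (\<lambda>x. c * f x) differentiable (at x within X)}"
    by (rule negligible_subset) (auto intro: differentiable_mult)
qed

lemma cont_aediff_minus: "cont_aediff X f \<Longrightarrow> cont_aediff X (\<lambda>x. - f x)"
  using cont_aediff_mult_left[of X f "-1"] by simp

lemma cont_aediff_divide: "cont_aediff X f \<Longrightarrow> cont_aediff X (\<lambda>x. f x / c)"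
  using cont_aediff_mult_left[of X f "inverse c"] by (simp add: field_simps)

lemma cont_aediff_sum:
  "(\<And>i. i \<in> I \<Longrightarrow> cont_aediff X (f i)) \<Longrightarrow> cont_aediff X (\<lambda>x. \<Sum>i\<in>I. f i x)"
  by (induction I rule: infinite_finite_induct) (auto intro: cont_aediff_const cont_aediff_add)

lemma cont_aediff_sum_list:
  "(\<And>f. f \<in> set fs \<Longrightarrow> cont_aediff X (F f)) \<Longrightarrow> cont_aediff X (\<lambda>x. \<Sum>f\<leftarrow>fs. F f x)"
  by (induction fs) (auto intro: cont_aediff_const cont_aediff_add)

lemma continuous_on_Min:
  fixes f :: "'i \<Rightarrow> 'a::topological_space \<Rightarrow> real"
  assumes "finite I" "I \<noteq> {}" "\<And>i. i \<in> I \<Longrightarrow> continuous_on X (f i)"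
  shows "continuous_on X (\<lambda>x. Min ((\<lambda>i. f i x) ` I))"
  using assms by (induction I rule: finite_ne_induct) (auto intro!: continuous_on_min)

lemma cont_aediff_Min:
  assumes "finite I" "I \<noteq> {}" "\<And>i. i \<in> I \<Longrightarrow> cont_aediff X (f i)"
  shows "cont_aediff X (\<lambda>x. Min ((\<lambda>i. f i x) ` I))"
proof (rule cont_aediff_selection[of I])
  show "continuous_on X (\<lambda>x. Min ((\<lambda>i. f i x) ` I))"
    using assms by (intro continuous_on_Min) (auto simp: cont_aediff_def)
  show "\<exists>i\<in>I. Min ((\<lambda>i. f i x) ` I) = f i x" for x
    using Min_in[of "(\<lambda>i. f i x) ` I"] assms(1,2) by (simp add: image_iff)
qed (use assms in auto)

section \<open>Smooth branches and linear bounds of \<open>eta_conj\<close> and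
  \<open>eta_task\<close>\<close>

lemma differentiable_transform_open:
  assumes "f differentiable (at x)" "open S" "x \<in> S" "\<And>y. y \<in> S \<Longrightarrow> f y = g y"
  shows "g differentiable (at x)"
  using assms unfolding differentiable_def by (metis has_derivative_transform_within_open)

lemma differentiable_exp:
  fixes f :: "'a::real_normed_vector \<Rightarrow> real"
  shows "f differentiable (at x within X) \<Longrightarrow> (\<lambda>x. exp (f x)) differentiable (at x within X)"
  unfolding differentiable_def by (elim exE) (rule exI, erule has_derivative_exp)

lemma differentiable_fst_snd: "fst differentiable F" "snd differentiable F"
  by (auto intro: bounded_linear_imp_differentiable bounded_linear_fst bounded_linear_snd)

lemma open_fst_pos: "open {p :: real \<times> real. 0 < fst p}" "open {p :: real \<times> real. fst p < 0}"
  by (auto intro!: open_Collect_less continuous_intros)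

lemma eta_conj_differentiable:
  assumes "a \<noteq> 0"
  shows "case_prod eta_conj differentiable (at (a, b))"
proof (cases "a < 0")
  case True
  have "(\<lambda>p::real\<times>real. fst p * exp ((snd p - fst p) / fst p)) differentiable (at (a, b))"
    using assms by (intro differentiable_mult differentiable_exp differentiable_divide
        differentiable_diff differentiable_fst_snd) auto
  then show ?thesis
    by (rule differentiable_transform_open[OF _ open_fst_pos(2)]) (use True in \<open>auto simp: eta_conj_def\<close>)
next
  case False
  have "(\<lambda>p::real\<times>real. fst p * (2 - exp ((fst p - snd p) / fst p))) differentiable (at (a, b))"
    using assms by (intro differentiable_mult differentiable_exp differentiable_divide
        differentiable_diff differentiable_fst_snd differentiable_const) auto
  then show ?thesis
    by (rule differentiable_transform_open[OF _ open_fst_pos(1)]) (use assms False in \<open>auto simp: eta_conj_def\<close>)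
qed

text \<open>The hypothesis makes both exponents nonpositive, so \<open>m\<close> is multiplied by a
  factor between 0 and 1 if it is negative and between 1 and 2 if it is positive.\<close>

lemma abs_eta_conj_le:
  assumes "m \<le> \<eta>"
  shows "\<bar>eta_conj m \<eta>\<bar> \<le> 2 * \<bar>m\<bar>"
proof -
  consider "m < 0" | "m = 0" | "m > 0" by linarith
  then show ?thesis
  proof cases
    case 1
    have "\<bar>m\<bar> * exp ((\<eta> - m) / m) \<le> \<bar>m\<bar> * 1"
      using 1 assms by (intro mult_left_mono) (auto simp: divide_nonneg_neg)
    then show ?thesis using 1 by (simp add: eta_conj_def abs_mult del: mult_le_cancel_left1 exp_le_one_iff)
  next
    case 3
    have "exp ((m - \<eta>) / m) \<le> 1" using 3 assms by (simp add: divide_nonpos_pos)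
    then have "\<bar>2 - exp ((m - \<eta>) / m)\<bar> \<le> 2" using exp_gt_zero[of "(m - \<eta>) / m"] by linarith
    then show ?thesis using 3 by (simp add: eta_conj_def abs_mult)
  qed (simp add: eta_conj_def)
qed

lemma eta_task_differentiable:
  assumes "a \<noteq> 0"
  shows "case_prod (eta_task \<alpha>) differentiable (at (a, b))"
proof -
  have pos: "1 + exp z \<noteq> (0::real)" for z by (metis add_pos_pos exp_gt_zero less_irrefl zero_less_one)
  show ?thesis
  proof (cases "a < 0")
    case True
    have "(\<lambda>p::real\<times>real. - 2 * \<alpha> * (exp (- fst p) - 1) / (1 + exp (\<alpha> * (snd p - fst p)))) differentiable (at (a, b))"
      using pos by (intro differentiable_mult differentiable_exp differentiable_divide differentiable_add
          differentiable_diff differentiable_minus differentiable_fst_snd differentiable_const) auto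
    then show ?thesis
      by (rule differentiable_transform_open[OF _ open_fst_pos(2)]) (use True in \<open>auto simp: eta_task_def\<close>)
  next
    case False
    have "(\<lambda>p::real\<times>real. 2 * \<alpha> * (exp (fst p) - 1) / (1 + exp (- \<alpha> * (snd p - fst p)))) differentiable (at (a, b))"
      using pos by (intro differentiable_mult differentiable_exp differentiable_divide differentiable_add
          differentiable_diff differentiable_fst_snd differentiable_const) auto
    then show ?thesis
      by (rule differentiable_transform_open[OF _ open_fst_pos(1)]) (use assms False in \<open>auto simp: eta_task_def\<close>)
  qed
qed

text \<open>Both denominators exceed 1, and \<open>exp x - 1\<close> is at most
  \<open>x + x^2\<close>, hence at most \<open>2 * x\<close>, on \<open>[0, 1]\<close>.\<close>

lemma abs_eta_task_le:
  assumes "0 \<le> \<alpha>" "\<bar>m\<bar> \<le> 1"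
  shows "\<bar>eta_task \<alpha> m \<eta>\<bar> \<le> 4 * \<alpha> * \<bar>m\<bar>"
proof -
  \<comment> \<open>The exponent of the branch in force, so that one formula covers the absolute
    values of both branches.\<close>
  define z where "z = (if 0 < m then - \<alpha> * (\<eta> - m) else \<alpha> * (\<eta> - m))"
  have e0: "0 \<le> exp \<bar>m\<bar> - 1" by simp
  have "\<bar>m\<bar>\<^sup>2 \<le> \<bar>m\<bar>" using assms(2) power_decreasing[of 1 2 "\<bar>m\<bar>"] by simp
  then have e: "exp \<bar>m\<bar> - 1 \<le> 2 * \<bar>m\<bar>"
    using exp_bound[of "\<bar>m\<bar>"] assms(2) by simp
  have "\<bar>eta_task \<alpha> m \<eta>\<bar> = 2 * \<alpha> * (exp \<bar>m\<bar> - 1) / (1 + exp z)"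
    using assms(1) e0 by (auto simp: eta_task_def z_def abs_mult abs_if[of m] add_pos_pos)
  also have "\<dots> \<le> 2 * \<alpha> * (exp \<bar>m\<bar> - 1) / 1"
    using assms(1) e0 by (intro divide_left_mono) (auto simp: add_pos_pos)
  also have "\<dots> \<le> 2 * \<alpha> * (2 * \<bar>m\<bar>)"
    using assms(1) mult_left_mono[OF e, of "2 * \<alpha>"] by simp
  finally show ?thesis by simp
qed

section \<open>Robustness of formulas over arbitrary atoms\<close>

text \<open>The minimum is the \<open>u\<close> of \<open>cont_aediff_compose\<close>; no entry lies
  below it, which gives the linear bound.\<close>

lemma cont_aediff_A_exp:
  assumes "fs \<noteq> []" and fs: "\<And>f. f \<in> set fs \<Longrightarrow> cont_aediff X f"
  shows "cont_aediff X (\<lambda>x. A_exp \<beta> (map (\<lambda>f. f x) fs))"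
proof -
  define m where "m = (\<lambda>x. Min ((\<lambda>f. f x) ` set fs))"
  have m: "cont_aediff X m"
    unfolding m_def using assms by (intro cont_aediff_Min) auto
  have "cont_aediff X (\<lambda>x. eta_conj (m x) (f x))" if f: "f \<in> set fs" for f
  proof (rule cont_aediff_compose[OF m fs[OF f] eta_conj_differentiable])
    show "\<bar>eta_conj (m x) (f x)\<bar> \<le> 2 * \<bar>m x\<bar>" for x
      using f by (intro abs_eta_conj_le) (auto simp: m_def)
  qed
  then have "cont_aediff X (\<lambda>x. \<beta> * m x +
      (1 - \<beta>) * ((\<Sum>f\<leftarrow>fs. eta_conj (m x) (f x)) / real (length fs)))"
    using m by (intro cont_aediff_add cont_aediff_mult_left cont_aediff_divide cont_aediff_sum_list)
  then show ?thesis by (simp add: A_exp_def m_def o_def Let_def)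
qed

lemma cont_aediff_O_exp:
  assumes "fs \<noteq> []" "\<And>f. f \<in> set fs \<Longrightarrow> cont_aediff X f"
  shows "cont_aediff X (\<lambda>x. O_exp \<beta> (map (\<lambda>f. f x) fs))"
proof -
  have "cont_aediff X (\<lambda>x. A_exp \<beta> (map (\<lambda>f. f x) (map (\<lambda>f x. - f x) fs)))"
    using assms by (intro cont_aediff_A_exp) (auto intro: cont_aediff_minus)
  then show ?thesis
    by (simp add: O_exp_def o_def cont_aediff_minus)
qed

text \<open>Atoms stay abstract so that one induction serves both logics: the atoms are predicates
  in the inner one and tasks in the outer one.\<close>

lemma cont_aediff_rob:
  assumes "wf_fm P \<phi>" and "\<And>p t. P p \<Longrightarrow> cont_aediff X (\<lambda>x. r x p t)"
  shows "cont_aediff X (\<lambda>x. rob \<beta> \<rho> (r x) \<phi> t)"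
  using assms(1)
proof (induction \<phi> arbitrary: t)
  case (Conj \<phi>s)
  then show ?case
    using cont_aediff_A_exp[of "map (\<lambda>\<phi> x. rob \<beta> \<rho> (r x) \<phi> t) \<phi>s" X \<beta>] by (auto simp: o_def)
next
  case (Disj \<phi>s)
  then show ?case
    using cont_aediff_O_exp[of "map (\<lambda>\<phi> x. rob \<beta> \<rho> (r x) \<phi> t) \<phi>s" X \<beta>] by (auto simp: o_def)
next
  case (Ev a b \<psi>)
  \<comment> \<open>The list of times is nonempty since well-formedness gives
    \<open>a \<le> b\<close>.\<close>
  then show ?case
    using cont_aediff_O_exp[of "map (\<lambda>t' x. rob \<beta> \<rho> (r x) \<psi> t') [t + a..<Suc (t + b)]" X \<beta>]
    by (auto simp: o_def simp del: upt_Suc)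
next
  case (Until a b \<phi> \<psi>)
  let ?g = "\<lambda>t' x. A_exp \<beta> (rob \<beta> \<rho> (r x) \<psi> t' # map (\<lambda>t''. rob \<beta> \<rho> (r x) \<phi> t'') [t..<t'])"
  \<comment> \<open>The entry for \<open>\<psi>\<close> keeps this list nonempty even when
    \<open>[t..<t']\<close> is empty.\<close>
  have "cont_aediff X (?g t')" for t'
    using Until cont_aediff_A_exp[of
        "(\<lambda>x. rob \<beta> \<rho> (r x) \<psi> t') # map (\<lambda>t'' x. rob \<beta> \<rho> (r x) \<phi> t'') [t..<t']" X \<beta>]
    by (auto simp: o_def)
  then show ?case
    using Until.prems cont_aediff_O_exp[of "map ?g [t + a..<Suc (t + b)]" X \<beta>]
    by (auto simp: o_def simp del: upt_Suc)
qed (auto intro: assms(2) cont_aediff_const cont_aediff_minus)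

section \<open>Order statistics\<close>

text \<open>In a descending list the entries that are at least \<open>a\<close> form an initial
  segment. Indices start at 0, hence the strict inequality.\<close>

lemma le_nth_sorted_desc_iff:
  fixes xs :: "'a::linorder list"
  assumes "sorted_wrt (\<ge>) xs" "k < length xs"
  shows "a \<le> xs ! k \<longleftrightarrow> k < length (filter ((\<le>) a) xs)"
  using assms
proof (induction xs arbitrary: k)
  case (Cons x xs)
  show ?case
  proof (cases "a \<le> x")
    case True
    with Cons show ?thesis by (cases k) auto
  next
    case False
    then have "\<forall>y\<in>set (x # xs). \<not> a \<le> y" using Cons.prems by auto
    moreover have "(x # xs) ! k \<in> set (x # xs)" using Cons.prems nth_mem by blast
    ultimately show ?thesis by (auto simp: filter_empty_conv)
  qed
qed simp

lemma mset_desc_values: "mset (desc_values f A) = image_mset f (mset_set A)"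
  by (simp add: desc_values_def)

lemma length_desc_values: "length (desc_values f A) = card A"
  using arg_cong[OF mset_desc_values, of size f A] by simp

text \<open>This trades the sorted list for a count that refers to no ordering of \<open>A\<close>,
  so changes of \<open>f\<close> can be followed agent by agent.\<close>

lemma le_nth_desc_values_iff:
  assumes "finite A" "k < card A"
  shows "a \<le> desc_values f A ! k \<longleftrightarrow> k < card {j \<in> A. a \<le> f j}"
proof -
  have "sorted_wrt (\<ge>) (desc_values f A)"
    by (simp add: desc_values_def sorted_wrt_rev)
  moreover have "length (filter ((\<le>) a) (desc_values f A)) = card {j \<in> A. a \<le> f j}"
    using assms
    by (simp flip: size_mset add: mset_desc_values filter_mset_image_mset)
  ultimately show ?thesis
    using assms by (simp add: le_nth_sorted_desc_iff length_desc_values)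
qed

text \<open>Every agent that \<open>f\<close> puts above a threshold is put by \<open>g\<close>
  above the threshold lowered by \<open>e\<close>. Used in both directions, this makes order
  statistics 1-Lipschitz in the maximum norm.\<close>

lemma nth_desc_values_mono:
  assumes "finite A" "k < card A" "\<And>j. j \<in> A \<Longrightarrow> f j \<le> g j + e"
  shows "desc_values f A ! k \<le> desc_values g A ! k + e"
proof -
  let ?a = "desc_values f A ! k"
  have "k < card {j \<in> A. ?a \<le> f j}"
    using assms le_nth_desc_values_iff[of A k ?a f] by simp
  also have "\<dots> \<le> card {j \<in> A. ?a - e \<le> g j}"
    using assms by (intro card_mono) force+
  finally have "?a - e \<le> desc_values g A ! k"
    using assms by (simp add: le_nth_desc_values_iff)
  then show ?thesis by simp
qed

lemma continuous_on_nth_desc_values: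
  assumes "finite A" "k < card A" "\<And>j. j \<in> A \<Longrightarrow> continuous_on X (f j)"
  shows "continuous_on X (\<lambda>x. desc_values (\<lambda>j. f j x) A ! k)"
  unfolding continuous_on_def
proof (intro ballI tendstoI)
  fix x e assume x: "x \<in> X" and e: "(0::real) < e"
  have "\<forall>\<^sub>F y in at x within X. \<forall>j\<in>A. dist (f j y) (f j x) < e / 2"
    using assms x e by (intro eventually_ball_finite ballI tendstoD) (auto simp: continuous_on_def)
  then show "\<forall>\<^sub>F y in at x within X.
      dist (desc_values (\<lambda>j. f j y) A ! k) (desc_values (\<lambda>j. f j x) A ! k) < e"
  proof eventually_elim
    case (elim y)
    then have le: "f j y \<le> f j x + e / 2" "f j x \<le> f j y + e / 2" if "j \<in> A" for j
      using bspec[OF elim that] by (auto simp only: dist_real_def abs_less_iff)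
    have "desc_values (\<lambda>j. f j y) A ! k \<le> desc_values (\<lambda>j. f j x) A ! k + e / 2"
      "desc_values (\<lambda>j. f j x) A ! k \<le> desc_values (\<lambda>j. f j y) A ! k + e / 2"
      using assms le by (auto intro!: nth_desc_values_mono)
    then show ?case using e by (auto simp: dist_real_def)
  qed
qed

text \<open>An order statistic is at each point the value of some agent, hence a continuous
  selection from the \<open>f j\<close>.\<close>

lemma cont_aediff_nth_desc_values:
  assumes "finite A" "k < card A" "\<And>j. j \<in> A \<Longrightarrow> cont_aediff X (f j)"
  shows "cont_aediff X (\<lambda>x. desc_values (\<lambda>j. f j x) A ! k)"
proof (rule cont_aediff_selection[of A])
  show "continuous_on X (\<lambda>x. desc_values (\<lambda>j. f j x) A ! k)"
    using assms by (intro continuous_on_nth_desc_values) (auto simp: cont_aediff_def)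
  fix x
  have "desc_values (\<lambda>j. f j x) A ! k \<in> set (desc_values (\<lambda>j. f j x) A)"
    using assms by (simp add: length_desc_values)
  also have "\<dots> = (\<lambda>j. f j x) ` A"
    using assms(1) by (simp flip: set_mset_mset add: mset_desc_values)
  finally show "\<exists>i\<in>A. desc_values (\<lambda>j. f j x) A ! k = f i x" by auto
qed (use assms in auto)

section \<open>Tasks and team robustness\<close>

lemma cont_aediff_eta_task:
  assumes "0 \<le> \<alpha>" "cont_aediff X m" "cont_aediff X f"
  shows "cont_aediff X (\<lambda>x. eta_task \<alpha> (m x) (f x))"
  by (rule cont_aediff_compose[OF assms(2,3) eta_task_differentiable])
    (use abs_eta_task_le assms(1) in auto)

lemma cont_aediff_rob_task:
  fixes cap :: "'j::finite \<Rightarrow> 'c set"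
  assumes "0 \<le> \<alpha>" and "wf_task S Cap cap T"
    and h: "\<And>h j t. h differentiable_on S \<Longrightarrow> cont_aediff X (\<lambda>x. h (s x j t))"
  shows "cont_aediff X (\<lambda>x. rob_task \<alpha> \<beta> \<rho> cap (s x) T t)"
proof (cases T)
  case (Task \<phi> c m)
  define A where "A = capable cap c"
  define f where "f = (\<lambda>j x. rob_stl \<beta> \<rho> (s x j) \<phi> t)"
  \<comment> \<open>With indices from 0 the \<open>m\<close>-th largest value is entry
    \<open>m - 1\<close>; \<open>1 \<le> m\<close> makes this subtraction exact.\<close>
  have m: "m - 1 < card A" and wf: "wf_stl S \<phi>"
    using assms(2) by (auto simp: Task A_def)
  have f: "cont_aediff X (f j)" for j
    using wf h unfolding f_def rob_stl_def wf_stl_def by (rule cont_aediff_rob)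
  \<comment> \<open>The sum is symmetric in the values, so it can be taken over agents; the ordering
    survives only in the reference entry.\<close>
  have "(\<Sum>\<eta>\<leftarrow>desc_values g A. G \<eta>) = (\<Sum>j\<in>A. G (g j))" for g and G :: "real \<Rightarrow> real"
    by (simp flip: sum_mset_sum_list add: mset_desc_values image_mset.compositionality o_def sum_unfold_sum_mset)
  then have "rob_task \<alpha> \<beta> \<rho> cap (s x) T t =
      (\<Sum>j\<in>A. eta_task \<alpha> (desc_values (\<lambda>j. f j x) A ! (m - 1)) (f j x)) / real (card A)" for x
    by (simp add: Task A_def f_def Let_def)
  moreover have "cont_aediff X (\<lambda>x.
      (\<Sum>j\<in>A. eta_task \<alpha> (desc_values (\<lambda>j. f j x) A ! (m - 1)) (f j x)) / real (card A))"
    using assms(1) m f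
    by (intro cont_aediff_divide cont_aediff_sum cont_aediff_eta_task cont_aediff_nth_desc_values) auto
  ultimately show ?thesis by simp
qed

text \<open>Reading off one position is linear and maps \<open>team_positions S\<close> into
  \<open>S\<close>, so the chain rule applies within these sets.\<close>

lemma cont_aediff_position:
  fixes S :: "(real^'n::finite) set" and \<tau> :: "nat \<Rightarrow> 'k::finite"
  assumes h: "h differentiable_on S"
  shows "cont_aediff (team_positions S :: (real^'n^'k^'j::finite) set) (\<lambda>x. h (trajectories \<tau> x j i))"
proof (rule cont_aediff_differentiable_on)
  let ?p = "\<lambda>x :: real^'n^'k^'j. x $ j $ \<tau> i"
  have "bounded_linear ?p"
    using bounded_linear_compose[OF bounded_linear_vec_nth bounded_linear_vec_nth] .
  then have "?p differentiable_on team_positions S"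
    by (intro differentiable_at_imp_differentiable_on bounded_linear_imp_differentiable)
  moreover have "h differentiable_on ?p ` team_positions S"
    using h by (rule differentiable_on_subset) (auto simp: team_positions_def)
  ultimately have "(\<lambda>x. h (?p x)) differentiable_on (team_positions S :: (real^'n^'k^'j) set)"
    by (rule differentiable_on_compose)
  then show "(\<lambda>x. h (trajectories \<tau> x j i)) differentiable_on
      (team_positions S :: (real^'n^'k^'j) set)"
    by (simp add: trajectories_def)
qed

theorem proposition3:
  fixes \<alpha> \<beta> \<rho> :: real
    and S :: "(real^'n::finite) set"
    and Cap :: "'c set"
    and cap :: "'j::finite \<Rightarrow> 'c set"
    and \<Phi> :: "(real^'n, 'c) catl"
    and t H :: nat
    and \<tau> :: "nat \<Rightarrow> 'k::finite"
  assumes "\<alpha> > 0" and "\<beta> \<in> {0..1}" and "\<rho> > 0"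
    and "finite Cap" and "(\<Union>j. cap j) = Cap"
    and "wf_catl S Cap cap \<Phi>"
    and "t + horizon_catl \<Phi> \<le> H"
    and "bij_betw \<tau> {0..H} UNIV"
  shows "continuous_on (team_positions S :: (real^'n^'k^'j) set)
           (\<lambda>x. rob_catl \<alpha> \<beta> \<rho> cap (trajectories \<tau> x) \<Phi> t) \<and>
         (AE x in (lebesgue :: (real^'n^'k^'j) measure). x \<in> team_positions S \<longrightarrow>
           (\<lambda>x. rob_catl \<alpha> \<beta> \<rho> cap (trajectories \<tau> x) \<Phi> t)
             differentiable (at x within team_positions S))"
proof -
  let ?X = "team_positions S :: (real^'n^'k^'j) set"
  let ?\<eta> = "\<lambda>x :: real^'n^'k^'j. rob_catl \<alpha> \<beta> \<rho> cap (trajectories \<tau> x) \<Phi> t"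
  \<comment> \<open>Tasks are the atoms of the outer logic; all times are covered because temporal
    operators shift the time.\<close>
  have "cont_aediff ?X (\<lambda>x. rob_task \<alpha> \<beta> \<rho> cap (trajectories \<tau> x) T t)"
    if "wf_task S Cap cap T" for T t
    using \<open>\<alpha> > 0\<close> that cont_aediff_position by (intro cont_aediff_rob_task) auto
  with \<open>wf_catl S Cap cap \<Phi>\<close> have "cont_aediff ?X ?\<eta>"
    unfolding rob_catl_def wf_catl_def by (rule cont_aediff_rob)
  then have "continuous_on ?X ?\<eta>"
    and "{x \<in> ?X. \<not> ?\<eta> differentiable (at x within ?X)} \<in> null_sets lebesgue"
    by (auto simp: cont_aediff_def negligible_iff_null_sets)
  then show ?thesis
    by (auto intro: AE_I')
qed

end
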